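(* There is no cubic vertex-transitive tricirculant of Type 4 of order at least $54$.
   Context: All graphs are finite and simple; cubic means connected and $3$-regular; a tricirculant is a connected graph admitting a cyclic group of automorphisms with exactly three vertex-orbits, all of equal size larger than $1$. For a positive integer $k$ and $r,s\in\mathbb{Z}_{2k}$, $T_4(k,r,s)$ is the graph with vertex set $\{u_i,v_i,w_i: i\in\mathbb{Z}_{2k}\}$ and edges $u_iu_{i+k}$, $u_iv_i$, $u_iw_i$, $w_iw_{i+r}$, $v_iv_{i+s}$ ($i\in\mathbb{Z}_{2k}$). A cubic tricirculant is of Type 4 if it is isomorphic to $T_4(k,r,s)$ for some positive integer $k$ and some $r,s\in\mathbb{Z}_{2k}$. *)

theory Defs
  imports
    "Graph_Theory.Graph_Theory"
    "HOL-Algebra.Group_Action"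
    "HOL-Algebra.Elementary_Groups"
begin

text \<open>
  A finite simple graph is a \<open>pair_graph\<close>: a finite, loop-free, symmetric digraph whose arcs are
  ordered pairs, an edge \<open>uv\<close> being the two arcs \<open>(u, v)\<close> and \<open>(v, u)\<close>.
  In particular \<open>out_degree\<close> is the degree, and \<open>digraph_iso\<close> is isomorphism of graphs.
\<close>

definition graph_auts :: "'a pair_pre_digraph \<Rightarrow> ('a \<Rightarrow> 'a) set" where
  "graph_auts G = {f \<in> Bij (pverts G).
     \<forall>u \<in> pverts G. \<forall>v \<in> pverts G. (u, v) \<in> parcs G \<longleftrightarrow> (f u, f v) \<in> parcs G}"

definition aut_group :: "'a pair_pre_digraph \<Rightarrow> ('a \<Rightarrow> 'a) monoid" where
  "aut_group G = BijGroup (pverts G) \<lparr>carrier := graph_auts G\<rparr>"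

lemma subgroup_graph_auts: "subgroup (graph_auts G) (BijGroup (pverts G))"
proof (rule group.subgroupI[OF group_BijGroup])
  show "graph_auts G \<subseteq> carrier (BijGroup (pverts G))"
    by (auto simp: graph_auts_def BijGroup_def)
  have "(\<lambda>x\<in>pverts G. x) \<in> graph_auts G"
    by (auto simp: graph_auts_def id_Bij)
  then show "graph_auts G \<noteq> {}" by blast
next
  fix f assume f: "f \<in> graph_auts G"
  then have B: "f \<in> Bij (pverts G)" by (simp add: graph_auts_def)
  let ?g = "\<lambda>x\<in>pverts G. inv_into (pverts G) f x"
  have im: "f ` pverts G = pverts G" using B by (auto simp: Bij_def bij_betw_def)
  have "(u, v) \<in> parcs G \<longleftrightarrow> (?g u, ?g v) \<in> parcs G"
    if uv: "u \<in> pverts G" "v \<in> pverts G" for u v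
  proof -
    have "inv_into (pverts G) f u \<in> pverts G" "inv_into (pverts G) f v \<in> pverts G"
      using B uv by (auto intro: Bij_inv_into_mem)
    moreover have "f (inv_into (pverts G) f u) = u" "f (inv_into (pverts G) f v) = v"
      using im uv by (auto intro: f_inv_into_f)
    ultimately show ?thesis using f uv unfolding graph_auts_def by fastforce
  qed
  then show "inv\<^bsub>BijGroup (pverts G)\<^esub> f \<in> graph_auts G"
    using B by (simp add: inv_BijGroup graph_auts_def restrict_inv_into_Bij)
next
  fix f g assume fg: "f \<in> graph_auts G" "g \<in> graph_auts G"
  then have B: "f \<in> Bij (pverts G)" "g \<in> Bij (pverts G)" by (auto simp: graph_auts_def)
  have "g x \<in> pverts G" if "x \<in> pverts G" for x
    using B(2) that Bij_imp_funcset by blast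
  then show "f \<otimes>\<^bsub>BijGroup (pverts G)\<^esub> g \<in> graph_auts G"
    using fg B by (auto simp: BijGroup_def graph_auts_def compose_Bij compose_eq)
qed

lemma group_aut_group: "group (aut_group G)"
  unfolding aut_group_def
  by (rule subgroup.subgroup_is_group[OF subgroup_graph_auts group_BijGroup])

lemma group_action_aut_group: "group_action (aut_group G) (pverts G) (\<lambda>f. f)"
proof -
  have "(\<lambda>f. f) \<in> hom (aut_group G) (BijGroup (pverts G))"
    using subgroup.subset[OF subgroup_graph_auts[of G]]
    by (auto simp: hom_def aut_group_def)
  then show ?thesis
    by (intro group_action.intro group_hom.intro group_hom_axioms.intro
        group_aut_group group_BijGroup)
qed

definition vertex_transitive :: "'a pair_pre_digraph \<Rightarrow> bool" where
  "vertex_transitive G \<longleftrightarrow> transitive_action (aut_group G) (pverts G) (\<lambda>f. f)"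

definition cubic :: "'a pair_pre_digraph \<Rightarrow> bool" where
  "cubic G \<longleftrightarrow> pair_graph G \<and> connected (with_proj G) \<and>
     (\<forall>v \<in> pverts G. out_degree (with_proj G) v = 3)"

definition tricirculant :: "'a pair_pre_digraph \<Rightarrow> bool" where
  "tricirculant G \<longleftrightarrow> pair_graph G \<and> connected (with_proj G) \<and>
     (\<exists>H m. subgroup H (aut_group G) \<and> cyclic_group (aut_group G \<lparr>carrier := H\<rparr>) \<and>
        card (orbits (aut_group G \<lparr>carrier := H\<rparr>) (pverts G) (\<lambda>f. f)) = 3 \<and> 1 < m \<and>
        (\<forall>B \<in> orbits (aut_group G \<lparr>carrier := H\<rparr>) (pverts G) (\<lambda>f. f). card B = m))"

datatype t4_vertex = U nat | V nat | W nat

text \<open>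
  The residues modulo \<open>2 * k\<close> are represented by \<open>{..<2 * k}\<close>, for the indices as well as for the
  parameters \<open>r\<close> and \<open>s\<close>. For \<open>r = 0\<close> or \<open>s = 0\<close> the formula for the edges yields loops; these are
  kept, so that in this degenerate case the result is not isomorphic to any \<open>pair_graph\<close>.
  (Without the loops it would have vertices of degree one, hence not be cubic either.)
\<close>

definition T4_edges :: "nat \<Rightarrow> nat \<Rightarrow> nat \<Rightarrow> t4_vertex rel" where
  "T4_edges k r s = (\<Union>i<2 * k.
     {(U i, U ((i + k) mod (2 * k))), (U i, V i), (U i, W i),
      (W i, W ((i + r) mod (2 * k))), (V i, V ((i + s) mod (2 * k)))})"

definition T4 :: "nat \<Rightarrow> nat \<Rightarrow> nat \<Rightarrow> t4_vertex pair_pre_digraph" where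
  "T4 k r s = \<lparr>pverts = U ` {..<2 * k} \<union> V ` {..<2 * k} \<union> W ` {..<2 * k},
     parcs = T4_edges k r s \<union> (T4_edges k r s)\<inverse>\<rparr>"

lemma wf_T4: "wf_digraph (with_proj (T4 k r s))"
  by unfold_locales (auto simp: T4_def T4_edges_def)

definition type4 :: "'a pair_pre_digraph \<Rightarrow> bool" where
  "type4 G \<longleftrightarrow> (\<exists>k r s. 0 < k \<and> r < 2 * k \<and> s < 2 * k \<and>
     digraph_iso (with_proj G) (with_proj (T4 k r s)))"

end

theory Submission
  imports Defs
begin

text \<open>
  In a vertex-transitive graph the number of closed walks of length 8 through a vertex that never
  backtrack, not even between the last and the first step, is the same for all vertices. In
  \<open>T\<^sub>4(k,r,s)\<close> such a walk is a word in the base graph whose total shift \<open>a s + b r + c k\<close> vanishes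
  modulo \<open>2k\<close>, and only a few shifts occur. The walks with trivial shift make the count at \<open>u\<close>
  larger than those at \<open>v\<close> and \<open>w\<close>. To correct the count at \<open>v\<close> one of \<open>5s = k\<close> and \<open>3s = \<plusminus>r\<close> must
  hold, and one of \<open>5r = k\<close> and \<open>3r = \<plusminus>s\<close> for \<open>w\<close>. Two such relations either make the orders of
  \<open>r\<close> and \<open>s\<close> divide 8 or 10, hence \<open>2k \<le> 10\<close> by connectedness, or fail to balance the counts.
\<close>

section \<open>Non-backtracking walks and their invariance\<close>

text \<open>
  \<open>nb_walks E n\<close> is the \<open>n\<close>-th power of the Hashimoto (non-backtracking) matrix of \<open>E\<close>; using its
  diagonal below excludes closed walks whose last arc is the reverse of the first one.
\<close>

primrec nb_walks :: "'v rel \<Rightarrow> nat \<Rightarrow> 'v \<times> 'v \<Rightarrow> 'v \<times> 'v \<Rightarrow> nat" where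
  "nb_walks E 0 e e' = of_bool (e = e')"
| "nb_walks E (Suc n) e e' =
    (\<Sum>z \<in> {z. (snd e, z) \<in> E \<and> z \<noteq> fst e}. nb_walks E n (snd e, z) e')"

definition nb_closed_walks :: "'v rel \<Rightarrow> nat \<Rightarrow> 'v \<Rightarrow> nat" where
  "nb_closed_walks E n x = (\<Sum>y \<in> {y. (x, y) \<in> E}. nb_walks E n (x, y) (x, y))"

context
  fixes f :: "'v \<Rightarrow> 'w" and A :: "'v set" and E :: "'v rel" and E' :: "'w rel"
  assumes inj: "inj_on f A" and E: "E \<subseteq> A \<times> A" and E': "E' = map_prod f f ` E"
begin

lemma image_arc_iff: "x \<in> A \<Longrightarrow> (f x, y') \<in> E' \<longleftrightarrow> (\<exists>y. y' = f y \<and> (x, y) \<in> E)"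
  using inj E unfolding E' by (auto dest: inj_onD)

lemma nb_walks_image:
  "\<lbrakk>x \<in> A; y \<in> A; a \<in> A; b \<in> A\<rbrakk> \<Longrightarrow>
    nb_walks E' n (f x, f y) (f a, f b) = nb_walks E n (x, y) (a, b)"
proof (induction n arbitrary: x y)
  case 0
  then show ?case using inj by (simp add: inj_on_eq_iff)
next
  case (Suc n)
  have "{z. (f y, z) \<in> E' \<and> z \<noteq> f x} = f ` {z. (y, z) \<in> E \<and> z \<noteq> x}"
    using Suc.prems inj E by (auto simp: image_arc_iff dest: inj_onD)
  moreover have "inj_on f {z. (y, z) \<in> E \<and> z \<noteq> x}"
    using E by (intro inj_on_subset[OF inj]) auto
  ultimately show ?case
    using Suc E by (auto simp: sum.reindex intro!: sum.cong)
qed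

text \<open>Serves twice: with \<open>f\<close> an automorphism of \<open>G\<close>, and with
  \<open>f\<close> the isomorphism from \<open>G\<close> onto \<open>T4 k r s\<close>.\<close>

lemma nb_closed_walks_image:
  assumes "x \<in> A"
  shows "nb_closed_walks E' n (f x) = nb_closed_walks E n x"
proof -
  have "{y. (f x, y) \<in> E'} = f ` {y. (x, y) \<in> E}"
    using assms by (auto simp: image_arc_iff)
  moreover have "inj_on f {y. (x, y) \<in> E}"
    using E by (intro inj_on_subset[OF inj]) auto
  ultimately show ?thesis
    using E assms
    by (auto simp: nb_closed_walks_def sum.reindex nb_walks_image intro!: sum.cong)
qed

lemma card_image_neighbours:
  assumes "x \<in> A"
  shows "card {y. (f x, y) \<in> E'} = card {y. (x, y) \<in> E}"
proof -
  have "{y. (f x, y) \<in> E'} = f ` {y. (x, y) \<in> E}"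
    using assms by (auto simp: image_arc_iff)
  then show ?thesis
    using E by (auto intro!: card_image inj_on_subset[OF inj])
qed

end

text \<open>For use at vertices of degree three, where an arc has exactly two continuations.\<close>

lemma nb_walks_Suc_two:
  assumes "\<And>t. (y, t) \<in> E \<and> t \<noteq> x \<longleftrightarrow> t = z \<or> t = z'" "z \<noteq> z'"
  shows "nb_walks E (Suc n) (x, y) e = nb_walks E n (y, z) e + nb_walks E n (y, z') e"
proof -
  have "{t. (y, t) \<in> E \<and> t \<noteq> x} = {z, z'}" using assms(1) by auto
  then show ?thesis using assms(2) by simp
qed

lemma vertex_transitive_nb_closed_walks:
  assumes "pair_graph G" "vertex_transitive G" "x \<in> pverts G" "y \<in> pverts G"
  shows "nb_closed_walks (parcs G) n x = nb_closed_walks (parcs G) n y"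
proof -
  interpret pair_graph G by fact
  obtain g where g: "g \<in> graph_auts G" "g x = y"
    using assms transitive_action.unique_orbit[of "aut_group G" "pverts G" "\<lambda>f. f"]
    unfolding vertex_transitive_def aut_group_def by auto
  then have bij: "bij_betw g (pverts G) (pverts G)"
    by (auto simp: graph_auts_def Bij_def)
  have sub: "parcs G \<subseteq> pverts G \<times> pverts G"
    using wellformed' by auto
  \<comment> \<open>An automorphism respects arcs in both directions, so the arc set is its own
    image.\<close>
  have im: "parcs G = map_prod g g ` parcs G"
  proof (intro equalityI subrelI)
    fix a b assume ab: "(a, b) \<in> parcs G"
    then have "a \<in> g ` pverts G" "b \<in> g ` pverts G"
      using bij sub by (auto simp: bij_betw_def)
    then obtain c d where "c \<in> pverts G" "d \<in> pverts G" "a = g c" "b = g d" by blast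
    then show "(a, b) \<in> map_prod g g ` parcs G"
      using ab g(1) by (force simp: graph_auts_def)
  next
    fix a b assume "(a, b) \<in> map_prod g g ` parcs G"
    then show "(a, b) \<in> parcs G"
      using g(1) sub by (auto simp: graph_auts_def)
  qed
  show ?thesis
    using nb_closed_walks_image[OF bij_betw_imp_inj_on[OF bij] sub im assms(3)] g(2) by simp
qed

section \<open>The graph \<open>T4\<close> with integer indices\<close>

locale T4_params =
  fixes k r s :: nat
  assumes k: "0 < k"
begin

abbreviation "E \<equiv> parcs (T4 k r s)"

text \<open>Indices are lifted to integers so that negative shifts make sense.\<close>

definition res :: "int \<Rightarrow> nat" where
  "res i = nat (i mod (2 * int k))"

lemma res_eq_iff: "res i = res j \<longleftrightarrow> 2 * int k dvd i - j"
  using k by (simp add: res_def eq_nat_nat_iff mod_eq_dvd_iff)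

lemma res_less: "res i < 2 * k"
  using k by (simp add: res_def nat_less_iff)

lemma res_of_nat: "m < 2 * k \<Longrightarrow> res (int m) = m"
  by (simp add: res_def)

lemma res_add_mod: "(res i + m) mod (2 * k) = res (i + int m)"
proof -
  have "int ((res i + m) mod (2 * k)) = int (res (i + int m))"
    using k by (simp add: res_def zmod_int mod_simps)
  then show ?thesis by simp
qed

lemma E_eq:
  "E = (let F = (\<Union>i. {(U (res i), U (res (i + int k))), (U (res i), V (res i)),
      (U (res i), W (res i)), (W (res i), W (res (i + int r))), (V (res i), V (res (i + int s)))})
    in F \<union> F\<inverse>)"
proof -
  have "{..<2 * k} = range res"
    using res_less res_of_nat by (auto simp: image_iff) (metis)
  then have "T4_edges k r s = (\<Union>i. {(U (res i), U (res (i + int k))), (U (res i), V (res i)),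
      (U (res i), W (res i)), (W (res i), W (res (i + int r))), (V (res i), V (res (i + int s)))})"
    by (simp add: T4_edges_def res_add_mod)
  then show ?thesis by (simp add: T4_def Let_def)
qed

lemma res_shift_eq: "res i = res (j + m) \<longleftrightarrow> res j = res (i - m)"
  by (auto simp: res_eq_iff algebra_simps dvd_diff_commute)

lemma res_add_cong: "res i = res j \<Longrightarrow> res (i + m) = res (j + m)"
  by (simp add: res_eq_iff)

lemma U_arc_iff: "(U (res i), z) \<in> E \<longleftrightarrow> z \<in> {U (res (i + int k)), V (res i), W (res i)}"
proof -
  have "(U (res i), z) \<in> E \<longleftrightarrow>
      (\<exists>j. res i = res j \<and> z \<in> {U (res (j + int k)), V (res j), W (res j)})
      \<or> (\<exists>j. res i = res (j + int k) \<and> z = U (res j))"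
    by (auto simp: E_eq Let_def)
  also have "(\<exists>j. res i = res j \<and> z \<in> {U (res (j + int k)), V (res j), W (res j)}) \<longleftrightarrow>
      z \<in> {U (res (i + int k)), V (res i), W (res i)}"
    by (metis res_add_cong)
  also have "(\<exists>j. res i = res (j + int k) \<and> z = U (res j)) \<longleftrightarrow> z = U (res (i - int k))"
    unfolding res_shift_eq by metis
  \<comment> \<open>The shifts \<open>k\<close> and \<open>- k\<close> agree modulo
    \<open>2 * k\<close>, so a \<open>U\<close> vertex has only one neighbour of the form
    \<open>U\<close>.\<close>
  also have "res (i - int k) = res (i + int k)"
    by (simp add: res_eq_iff)
  finally show ?thesis by auto
qed

lemma V_arc_iff: "(V (res i), z) \<in> E \<longleftrightarrow> z \<in> {U (res i), V (res (i + int s)), V (res (i - int s))}"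
proof -
  have "(V (res i), z) \<in> E \<longleftrightarrow>
      (\<exists>j. res i = res j \<and> z \<in> {U (res j), V (res (j + int s))})
      \<or> (\<exists>j. res i = res (j + int s) \<and> z = V (res j))"
    by (auto simp: E_eq Let_def)
  also have "(\<exists>j. res i = res j \<and> z \<in> {U (res j), V (res (j + int s))}) \<longleftrightarrow>
      z \<in> {U (res i), V (res (i + int s))}"
    by (metis res_add_cong)
  also have "(\<exists>j. res i = res (j + int s) \<and> z = V (res j)) \<longleftrightarrow> z = V (res (i - int s))"
    unfolding res_shift_eq by metis
  finally show ?thesis by simp
qed

lemma W_arc_iff: "(W (res i), z) \<in> E \<longleftrightarrow> z \<in> {U (res i), W (res (i + int r)), W (res (i - int r))}"
proof -
  have "(W (res i), z) \<in> E \<longleftrightarrow>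
      (\<exists>j. res i = res j \<and> z \<in> {U (res j), W (res (j + int r))})
      \<or> (\<exists>j. res i = res (j + int r) \<and> z = W (res j))"
    by (auto simp: E_eq Let_def)
  also have "(\<exists>j. res i = res j \<and> z \<in> {U (res j), W (res (j + int r))}) \<longleftrightarrow>
      z \<in> {U (res i), W (res (i + int r))}"
    by (metis res_add_cong)
  also have "(\<exists>j. res i = res (j + int r) \<and> z = W (res j)) \<longleftrightarrow> z = W (res (i - int r))"
    unfolding res_shift_eq by metis
  finally show ?thesis by simp
qed

lemma neighbours:
  "{z. (U (res i), z) \<in> E} = {U (res (i + int k)), V (res i), W (res i)}"
  "{z. (V (res i), z) \<in> E} = {U (res i), V (res (i + int s)), V (res (i - int s))}"
  "{z. (W (res i), z) \<in> E} = {U (res i), W (res (i + int r)), W (res (i - int r))}"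
  by (auto simp: U_arc_iff V_arc_iff W_arc_iff)

text \<open>The neighbours with indices \<open>i + s\<close> and \<open>i - s\<close> coincide here,
  likewise for \<open>r\<close>. Thus 3-regularity supplies the assumptions of
  \<open>type4_graph\<close>.\<close>

lemma degree_V: "2 * k dvd 2 * s \<Longrightarrow> card {z. (V (res i), z) \<in> E} \<noteq> 3"
  and degree_W: "2 * k dvd 2 * r \<Longrightarrow> card {z. (W (res i), z) \<in> E} \<noteq> 3"
proof -
  have "res (i - int m) = res (i + int m)" if "2 * k dvd 2 * m" for m
    using that int_dvd_int_iff[of "2 * k" "2 * m"] by (auto simp: res_eq_iff dvd_diff_commute)
  moreover have "card {a, b, b} \<noteq> 3" for a b :: t4_vertex
    by (cases "a = b") auto
  ultimately show "2 * k dvd 2 * s \<Longrightarrow> card {z. (V (res i), z) \<in> E} \<noteq> 3"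
    "2 * k dvd 2 * r \<Longrightarrow> card {z. (W (res i), z) \<in> E} \<noteq> 3"
    unfolding neighbours by metis+
qed

text \<open>The gcd \<open>d\<close> also divides the modulus, so along an edge it divides both
  indices or neither; a path from \<open>U 0\<close> to \<open>U 1\<close> forces \<open>d\<close>
  to divide 1.\<close>

lemma connected_imp_coprime:
  assumes "connected (with_proj (T4 k r s))"
  shows "gcd k (gcd r s) = 1"
proof -
  define d where "d = gcd k (gcd r s)"
  have d: "d dvd k" "d dvd r" "d dvd s" unfolding d_def by (blast intro: gcd_dvd1 gcd_dvd2 dvd_trans)+
  define P where "P v = (d dvd (case v of U i \<Rightarrow> i | V i \<Rightarrow> i | W i \<Rightarrow> i))" for v
  have P_E: "P x \<longleftrightarrow> P y" if "(x, y) \<in> E" for x y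
  proof -
    have "d dvd (i + m) mod (2 * k) \<longleftrightarrow> d dvd i" if "d dvd m" for i m
      using d that by (simp add: dvd_mod_iff dvd_add_left_iff)
    note mod = this[OF d(1)] this[OF d(2)] this[OF d(3)]
    show ?thesis using that unfolding T4_def T4_edges_def by (auto simp: P_def mod)
  qed
  have "P x \<longleftrightarrow> P y" if "(x, y) \<in> rtrancl_on A (E\<^sup>s)" for x y A
    using that by induction (auto simp: symcl_def dest: P_E)
  moreover have "(U 0, U 1) \<in> rtrancl_on (pverts (T4 k r s)) (E\<^sup>s)"
    using assms k unfolding connected_conv by (simp add: T4_def)
  ultimately have "P (U 0) \<longleftrightarrow> P (U 1)" by blast
  then show ?thesis by (simp add: P_def d_def)
qed

end

section \<open>Closed walks of length 8 counted by their shifts\<close>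

text \<open>
  The arcs up to rotation: \<open>VP\<close>, \<open>WP\<close> increase the index and \<open>VM\<close>, \<open>WM\<close> decrease it.
  In \<open>pos a b c\<close> the coefficients belong to \<open>s\<close>, \<open>r\<close>, \<open>k\<close>, in this order.
\<close>

datatype dart = UU | UV | UW | VU | VP | VM | WU | WP | WM

locale type4_graph = T4_params +
  assumes r: "\<not> 2 * k dvd 2 * r"
    and s: "\<not> 2 * k dvd 2 * s"
begin

definition pos :: "int \<Rightarrow> int \<Rightarrow> int \<Rightarrow> int" where
  "pos a b c = a * int s + b * int r + c * int k"

definition rel :: "int \<Rightarrow> int \<Rightarrow> int \<Rightarrow> bool" where
  "rel a b c \<longleftrightarrow> 2 * int k dvd pos a b c"

fun arc_of :: "dart \<Rightarrow> int \<Rightarrow> int \<Rightarrow> int \<Rightarrow> t4_vertex \<times> t4_vertex" where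
  "arc_of UU a b c = (U (res (pos a b c)), U (res (pos a b c + int k)))"
| "arc_of UV a b c = (U (res (pos a b c)), V (res (pos a b c)))"
| "arc_of UW a b c = (U (res (pos a b c)), W (res (pos a b c)))"
| "arc_of VU a b c = (V (res (pos a b c)), U (res (pos a b c)))"
| "arc_of VP a b c = (V (res (pos a b c)), V (res (pos a b c + int s)))"
| "arc_of VM a b c = (V (res (pos a b c)), V (res (pos a b c - int s)))"
| "arc_of WU a b c = (W (res (pos a b c)), U (res (pos a b c)))"
| "arc_of WP a b c = (W (res (pos a b c)), W (res (pos a b c + int r)))"
| "arc_of WM a b c = (W (res (pos a b c)), W (res (pos a b c - int r)))"

lemma not_dvd_twice: "\<not> 2 * int k dvd 2 * int r" "\<not> 2 * int k dvd 2 * int s"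
proof -
  have "2 * int k dvd 2 * int m \<longleftrightarrow> 2 * k dvd 2 * m" for m
    using int_dvd_int_iff[of "2 * k" "2 * m"] by simp
  then show "\<not> 2 * int k dvd 2 * int r" "\<not> 2 * int k dvd 2 * int s"
    using r s by auto
qed

lemma res_shift_neq:
  "res (i + int s) \<noteq> res (i - int s)" "res (i + int r) \<noteq> res (i - int r)"
  "res (i - int s) \<noteq> res (i + int s)" "res (i - int r) \<noteq> res (i + int r)"
  "res (2 * int s + i) \<noteq> res i" "res (2 * int r + i) \<noteq> res i"
  "res (i - 2 * int s) \<noteq> res i" "res (i - 2 * int r) \<noteq> res i"
  using not_dvd_twice unfolding res_eq_iff
  by (auto simp: algebra_simps dvd_diff_commute)

lemma res_twice_k: "res (2 * int k + i) = res i"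
  by (simp add: res_eq_iff)

text \<open>Darts such as \<open>VP\<close> and \<open>VM\<close> give distinct arcs because
  \<open>2 * s\<close> and \<open>2 * r\<close> are nonzero modulo \<open>2 * k\<close>.\<close>

lemma arc_eq_iff: "arc_of d a b c = arc_of d' 0 0 0 \<longleftrightarrow> d = d' \<and> rel a b c"
proof -
  have eq: "res (pos a b c + m) = res (pos 0 0 0 + m) \<longleftrightarrow> rel a b c"
    "res (pos a b c - m) = res (pos 0 0 0 - m) \<longleftrightarrow> rel a b c"
    "res (pos a b c) = res (pos 0 0 0) \<longleftrightarrow> rel a b c" for m
    by (simp_all add: res_eq_iff rel_def pos_def)
  have "res (pos a b c + int m) \<noteq> res (pos 0 0 0 - int m)"
    "res (pos a b c - int m) \<noteq> res (pos 0 0 0 + int m)"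
    if "rel a b c" "m = r \<or> m = s" for m
    using that res_shift_neq[of "pos 0 0 0"] eq(1,2)[of "int m"] by auto
  then show ?thesis
    by (cases d; cases d') (auto simp: eq)
qed

lemma nb_walks_arc_0: "nb_walks E 0 (arc_of d a b c) (arc_of d' 0 0 0) = of_bool (d = d' \<and> rel a b c)"
  by (simp add: arc_eq_iff)

lemma pos_shift:
  "pos (a + 1) b c = pos a b c + int s" "pos (a - 1) b c = pos a b c - int s"
  "pos a (b + 1) c = pos a b c + int r" "pos a (b - 1) c = pos a b c - int r"
  by (simp_all add: pos_def algebra_simps)

text \<open>Only the parity of the third coefficient matters; \<open>1 - c\<close> instead of
  \<open>c + 1\<close> keeps it 0 or 1, so that equal relations become equal terms.\<close>

lemma res_pos_shift_k: "res (pos a b (1 - c)) = res (pos a b c + int k)"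
proof -
  have "pos a b (1 - c) - (pos a b c + int k) = 2 * int k * (- c)"
    by (simp add: pos_def algebra_simps)
  then show ?thesis unfolding res_eq_iff by (metis dvd_triv_left)
qed

text \<open>Positions enter only through \<open>a\<close>, \<open>b\<close>, \<open>c\<close>, so
  walks are enumerated symbolically for all \<open>k\<close>, \<open>r\<close>, \<open>s\<close> at
  once.\<close>

lemma nb_walks_arc_Suc:
  "nb_walks E (Suc n) (arc_of UU a b c) e =
    nb_walks E n (arc_of UV a b (1 - c)) e + nb_walks E n (arc_of UW a b (1 - c)) e"
  "nb_walks E (Suc n) (arc_of UV a b c) e =
    nb_walks E n (arc_of VP a b c) e + nb_walks E n (arc_of VM a b c) e"
  "nb_walks E (Suc n) (arc_of UW a b c) e =
    nb_walks E n (arc_of WP a b c) e + nb_walks E n (arc_of WM a b c) e"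
  "nb_walks E (Suc n) (arc_of VU a b c) e =
    nb_walks E n (arc_of UU a b c) e + nb_walks E n (arc_of UW a b c) e"
  "nb_walks E (Suc n) (arc_of VP a b c) e =
    nb_walks E n (arc_of VU (a + 1) b c) e + nb_walks E n (arc_of VP (a + 1) b c) e"
  "nb_walks E (Suc n) (arc_of VM a b c) e =
    nb_walks E n (arc_of VU (a - 1) b c) e + nb_walks E n (arc_of VM (a - 1) b c) e"
  "nb_walks E (Suc n) (arc_of WU a b c) e =
    nb_walks E n (arc_of UU a b c) e + nb_walks E n (arc_of UV a b c) e"
  "nb_walks E (Suc n) (arc_of WP a b c) e =
    nb_walks E n (arc_of WU a (b + 1) c) e + nb_walks E n (arc_of WP a (b + 1) c) e"
  "nb_walks E (Suc n) (arc_of WM a b c) e =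
    nb_walks E n (arc_of WU a (b - 1) c) e + nb_walks E n (arc_of WM a (b - 1) c) e"
  unfolding arc_of.simps pos_shift res_pos_shift_k
  by (rule nb_walks_Suc_two;
      auto simp: U_arc_iff V_arc_iff W_arc_iff res_shift_neq res_twice_k)+

lemma nb_closed_walks_arcs:
  "nb_closed_walks E n (U 0) = (\<Sum>d \<leftarrow> [UU, UV, UW]. nb_walks E n (arc_of d 0 0 0) (arc_of d 0 0 0))"
  "nb_closed_walks E n (V 0) = (\<Sum>d \<leftarrow> [VU, VP, VM]. nb_walks E n (arc_of d 0 0 0) (arc_of d 0 0 0))"
  "nb_closed_walks E n (W 0) = (\<Sum>d \<leftarrow> [WU, WP, WM]. nb_walks E n (arc_of d 0 0 0) (arc_of d 0 0 0))"
proof -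
  have 0: "pos 0 0 0 = 0" "res 0 = 0" by (simp_all add: res_def pos_def)
  from neighbours[of 0] show
    "nb_closed_walks E n (U 0) = (\<Sum>d \<leftarrow> [UU, UV, UW]. nb_walks E n (arc_of d 0 0 0) (arc_of d 0 0 0))"
    "nb_closed_walks E n (V 0) = (\<Sum>d \<leftarrow> [VU, VP, VM]. nb_walks E n (arc_of d 0 0 0) (arc_of d 0 0 0))"
    "nb_closed_walks E n (W 0) = (\<Sum>d \<leftarrow> [WU, WP, WM]. nb_walks E n (arc_of d 0 0 0) (arc_of d 0 0 0))"
    using res_shift_neq(1,2)[of 0] by (simp_all add: nb_closed_walks_def 0)
qed

lemma rel_minus: "rel (- a) (- b) c = rel a b c"
proof -
  have "pos (- a) (- b) c = 2 * int k * c - pos a b c"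
    by (simp add: pos_def algebra_simps)
  then show ?thesis by (simp add: rel_def dvd_diff_right_iff)
qed

text \<open>As rewrite rules these make the leading coefficient positive, which merges shifts that
  differ by sign.\<close>

lemma rel_normalize:
  "rel (- numeral m) b c = rel (numeral m) (- b) c"
  "rel (- 1) b c = rel 1 (- b) c"
  "rel 0 (- numeral n) c = rel 0 (numeral n) c"
  using rel_minus[of "numeral m" "- b" c] rel_minus[of 1 "- b" c] rel_minus[of 0 "numeral n" c]
  by simp_all

lemma rel_trivial: "rel 0 0 0" "\<not> rel 2 0 0" "\<not> rel 0 2 0"
  using not_dvd_twice by (simp_all add: rel_def pos_def)

abbreviation \<chi> :: "int \<Rightarrow> int \<Rightarrow> int \<Rightarrow> nat" where
  "\<chi> a b c \<equiv> of_bool (rel a b c)"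

text \<open>The constants count the walks whose shift vanishes for all \<open>r\<close> and
  \<open>s\<close>: they run around \<open>u w w u u w w u\<close> with shifts \<open>r\<close>,
  \<open>k\<close>, \<open>- r\<close>, \<open>k\<close>, or likewise with \<open>v\<close> and
  \<open>s\<close>. Both families pass through \<open>u\<close>, only one through \<open>v\<close>
  or \<open>w\<close>.\<close>

lemma nb_closed_8_walks:
  "nb_closed_walks E 8 (U 0) =
    8 + 12 * (\<chi> 1 2 1 + \<chi> 1 (- 2) 1 + \<chi> 2 1 1 + \<chi> 2 (- 1) 1) + 8 * (\<chi> 1 1 0 + \<chi> 1 (- 1) 0)
    + 4 * (\<chi> 5 0 1 + \<chi> 0 5 1 + \<chi> 1 3 0 + \<chi> 1 (- 3) 0 + \<chi> 3 1 0 + \<chi> 3 (- 1) 0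
      + \<chi> 2 2 0 + \<chi> 2 (- 2) 0)"
  "nb_closed_walks E 8 (V 0) =
    4 + 12 * (\<chi> 5 0 1 + \<chi> 2 1 1 + \<chi> 2 (- 1) 1)
    + 8 * (\<chi> 1 2 1 + \<chi> 1 (- 2) 1 + \<chi> 3 1 0 + \<chi> 3 (- 1) 0)
    + 6 * (\<chi> 2 2 0 + \<chi> 2 (- 2) 0)
    + 4 * (\<chi> 1 1 0 + \<chi> 1 (- 1) 0 + \<chi> 1 3 0 + \<chi> 1 (- 3) 0) + 2 * \<chi> 8 0 0"
  "nb_closed_walks E 8 (W 0) =
    4 + 12 * (\<chi> 0 5 1 + \<chi> 1 2 1 + \<chi> 1 (- 2) 1)
    + 8 * (\<chi> 2 1 1 + \<chi> 2 (- 1) 1 + \<chi> 1 3 0 + \<chi> 1 (- 3) 0)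
    + 6 * (\<chi> 2 2 0 + \<chi> 2 (- 2) 0)
    + 4 * (\<chi> 1 1 0 + \<chi> 1 (- 1) 0 + \<chi> 3 1 0 + \<chi> 3 (- 1) 0) + 2 * \<chi> 0 8 0"
  unfolding nb_closed_walks_arcs
  \<comment> \<open>The rules for \<open>Suc\<close> are also instantiated at
    \<open>pred_numeral m\<close>, so that the numeral 8 unfolds.\<close>
  by (simp_all del: arc_of.simps nb_walks.simps add: rel_normalize rel_trivial
      nb_walks_arc_0 nb_walks_arc_Suc nb_walks_arc_Suc[of "pred_numeral m" for m, folded numeral_eq_Suc])

text \<open>Relations are closed under integer combinations, and \<open>2 * k\<close> is zero, so
  \<open>z\<close> only has to match in parity.\<close>

lemma rel_combine:
  assumes "rel a b c" "rel a' b' c'" "even (x * c + y * c' - z)"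
  shows "rel (x * a + y * a') (x * b + y * b') z"
proof -
  obtain t where t: "x * c + y * c' - z = 2 * t" using assms(3) by blast
  have "pos (x * a + y * a') (x * b + y * b') z
      = x * pos a b c + y * pos a' b' c' - (x * c + y * c' - z) * int k"
    by (simp add: pos_def algebra_simps)
  then show ?thesis
    using assms(1,2) unfolding rel_def t by (simp add: mult.assoc mult.left_commute)
qed

end

section \<open>Incompatible relations between the shifts\<close>

locale connected_type4_graph = type4_graph +
  assumes coprime: "gcd k (gcd r s) = 1"
    and large: "5 < k"
begin

text \<open>Here \<open>k\<close> divides \<open>m * s\<close> and \<open>m * r\<close>, hence also
  \<open>m * gcd k (gcd r s) = m\<close>, which is too small.\<close>

lemma not_rel_both:
  assumes "0 < m" "m \<le> 5" "rel (2 * int m) 0 0" "rel 0 (2 * int m) 0"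
  shows False
proof -
  have "2 * k dvd 2 * m * n" if "2 * int k dvd 2 * int m * int n" for n
    using that int_dvd_int_iff[of "2 * k" "2 * m * n"] by simp
  then have "k dvd m * s" "k dvd m * r"
    using assms(3,4) by (simp_all add: rel_def pos_def mult.assoc)
  then have "k dvd gcd (m * k) (gcd (m * r) (m * s))" by simp
  also have "\<dots> = m" using coprime by (simp flip: gcd_mult_distrib_nat)
  finally show False using assms(1,2) large by (auto dest: dvd_imp_le)
qed

lemma not_rel_8: "\<not> (rel 8 0 0 \<and> rel 0 8 0)"
  and not_rel_10: "\<not> (rel 10 0 0 \<and> rel 0 10 0)"
  using not_rel_both[of 4] not_rel_both[of 5] by auto

text \<open>Four times the relation makes \<open>8 s = 0\<close> and \<open>8 r = 0\<close>
  equivalent, and both together are excluded. Both signs at once would give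
  \<open>8 s = 0\<close>.\<close>

lemma rel_2_conflict:
  assumes "\<sigma> = 1 \<or> \<sigma> = - 1" "rel 2 (2 * \<sigma>) 0"
  shows "\<not> rel 8 0 0" "\<not> rel 0 8 0" "\<not> rel 2 (- 2 * \<sigma>) 0"
proof -
  have 1: "rel 8 0 0 \<longleftrightarrow> rel 0 8 0"
    using rel_combine[OF assms(2), of 8 0 0 "4 * \<sigma>" "- \<sigma>" 0]
      rel_combine[OF assms(2), of 0 8 0 4 "- \<sigma>" 0] assms(1)
    by auto
  then show "\<not> rel 8 0 0" "\<not> rel 0 8 0" using not_rel_8 by auto
  then show "\<not> rel 2 (- 2 * \<sigma>) 0"
    using rel_combine[OF assms(2), of 2 "- 2 * \<sigma>" 0 2 2 0] by auto
qed

text \<open>Eliminating either of \<open>r\<close>, \<open>s\<close> leaves the other with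
  coefficient 8 if the signs agree and 10 if not, up to sign.\<close>

lemma rel_3_conflict:
  assumes "\<sigma> = 1 \<or> \<sigma> = - 1" "\<tau> = 1 \<or> \<tau> = - 1" "rel 3 \<sigma> 0" "rel 1 (3 * \<tau>) 0"
  shows False
  using assms(1,2) not_rel_8 not_rel_10
    rel_combine[OF assms(3,4), of 3 "- 1" 0] rel_combine[OF assms(3,4), of 3 1 0]
    rel_combine[OF assms(3,4), of "- 1" 3 0] rel_combine[OF assms(3,4), of 1 "- 3" 0]
  by (auto simp: rel_normalize)

lemma rel_5_conflict: "rel 5 0 1 \<Longrightarrow> rel 0 5 1 \<Longrightarrow> False"
  using not_rel_10 rel_combine[of 5 0 1 0 5 1 2 0 0] rel_combine[of 5 0 1 0 5 1 0 2 0] by auto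

text \<open>Substituting \<open>r = s\<close> or \<open>r = - s\<close> reduces the excluded
  relations to one of \<open>2 s\<close>, \<open>4 s\<close>, \<open>2 r\<close>, \<open>4 r\<close>
  being zero; a zero among \<open>4 s\<close>, \<open>4 r\<close> would make both \<open>8 s\<close>
  and \<open>8 r\<close> zero.\<close>

lemma rel_1_conflict:
  assumes "\<sigma> = 1 \<or> \<sigma> = - 1" "rel 1 \<sigma> 0"
  shows "\<not> (rel 1 3 0 \<or> rel 1 (- 3) 0)" "\<not> (rel 3 1 0 \<or> rel 3 (- 1) 0)"
proof -
  have *: "\<not> rel 4 0 0" "\<not> rel 0 4 0" "\<not> rel 0 (- 4) 0"
    using not_rel_8 rel_combine[of 4 0 0 4 0 0 1 1 0] rel_combine[of 0 4 0 0 4 0 1 1 0]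
      rel_combine[OF assms(2), of 4 0 0 "8 * \<sigma>" "- 2 * \<sigma>" 0]
      rel_combine[OF assms(2), of 0 4 0 8 "- 2 * \<sigma>" 0] assms(1)
    by (auto simp: rel_normalize)
  show "\<not> (rel 1 3 0 \<or> rel 1 (- 3) 0)" "\<not> (rel 3 1 0 \<or> rel 3 (- 1) 0)"
    using assms(1) * rel_trivial
      rel_combine[OF assms(2), of 1 3 0 "- 1" 1 0] rel_combine[OF assms(2), of 1 "- 3" 0 "- 1" 1 0]
      rel_combine[OF assms(2), of 3 1 0 "- 1" 1 0] rel_combine[OF assms(2), of 3 "- 1" 0 "- 1" 1 0]
      rel_combine[OF assms(2), of 3 1 0 1 1 0] rel_combine[OF assms(2), of 3 "- 1" 0 1 1 0]
    by (auto simp: rel_normalize)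
qed

text \<open>Doubling removes \<open>k\<close>; elimination then leaves \<open>r\<close> alone (in
  the second part \<open>s\<close>) with coefficient 2 or 10 up to sign. The former is excluded
  outright, the latter by doubling the first relation.\<close>

lemma rel_5_3_conflict:
  assumes "\<sigma> = 1 \<or> \<sigma> = - 1" "\<tau> = 1 \<or> \<tau> = - 1"
  shows "rel 5 0 1 \<Longrightarrow> rel 1 (3 * \<sigma>) 0 \<Longrightarrow> \<not> rel 1 (2 * \<tau>) 1"
    and "rel 0 5 1 \<Longrightarrow> rel 3 \<sigma> 0 \<Longrightarrow> \<not> rel 2 \<tau> 1"
proof -
  assume 5: "rel 5 0 1" and 3: "rel 1 (3 * \<sigma>) 0"
  have "rel 10 0 0" using rel_combine[OF 5 5, of 1 1 0] by simp
  then have "\<not> rel 0 10 0" using not_rel_10 by auto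
  then show "\<not> rel 1 (2 * \<tau>) 1"
    using rel_combine[OF 3, of 1 "2 * \<tau>" 1 2 "- 2" 0] assms rel_trivial by (auto simp: rel_normalize)
next
  assume 5: "rel 0 5 1" and 3: "rel 3 \<sigma> 0"
  have "rel 0 10 0" using rel_combine[OF 5 5, of 1 1 0] by simp
  then have "\<not> rel 10 0 0" using not_rel_10 by auto
  then show "\<not> rel 2 \<tau> 1"
    using rel_combine[OF 3, of 2 \<tau> 1 2 "- 2" 0] rel_combine[OF 3, of 2 \<tau> 1 2 2 0] assms rel_trivial
    by (auto simp: rel_normalize)
qed

lemma nb_closed_8_walks_distinct:
  "\<not> (nb_closed_walks E 8 (U 0) = nb_closed_walks E 8 (V 0)
    \<and> nb_closed_walks E 8 (U 0) = nb_closed_walks E 8 (W 0))"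
proof
  assume *: "nb_closed_walks E 8 (U 0) = nb_closed_walks E 8 (V 0)
    \<and> nb_closed_walks E 8 (U 0) = nb_closed_walks E 8 (W 0)"
  have UV: "4 + 4 * (\<chi> 1 2 1 + \<chi> 1 (- 2) 1 + \<chi> 1 1 0 + \<chi> 1 (- 1) 0 + \<chi> 0 5 1)
      = 8 * \<chi> 5 0 1 + 4 * (\<chi> 3 1 0 + \<chi> 3 (- 1) 0) + 2 * (\<chi> 2 2 0 + \<chi> 2 (- 2) 0 + \<chi> 8 0 0)"
    using conjunct1[OF *] unfolding nb_closed_8_walks by simp
  have UW: "4 + 4 * (\<chi> 2 1 1 + \<chi> 2 (- 1) 1 + \<chi> 1 1 0 + \<chi> 1 (- 1) 0 + \<chi> 5 0 1)
      = 8 * \<chi> 0 5 1 + 4 * (\<chi> 1 3 0 + \<chi> 1 (- 3) 0) + 2 * (\<chi> 2 2 0 + \<chi> 2 (- 2) 0 + \<chi> 0 8 0)"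
    using conjunct2[OF *] unfolding nb_closed_8_walks by simp
  \<comment> \<open>The terms of weight 2 thus contribute at most 2, too little to balance the 4 on
    the left of \<open>UV\<close> and \<open>UW\<close>.\<close>
  have 2: "\<chi> 2 2 0 + \<chi> 2 (- 2) 0 + \<chi> 8 0 0 \<le> 1" "\<chi> 2 2 0 + \<chi> 2 (- 2) 0 + \<chi> 0 8 0 \<le> 1"
    using rel_2_conflict[of 1] rel_2_conflict[of "- 1"] by auto
  have V: "rel 5 0 1 \<or> rel 3 1 0 \<or> rel 3 (- 1) 0"
  proof (rule ccontr)
    assume "\<not> ?thesis"
    then show False using UV 2 by simp
  qed
  have W: "rel 0 5 1 \<or> rel 1 3 0 \<or> rel 1 (- 3) 0"
  proof (rule ccontr)
    assume "\<not> ?thesis"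
    then show False using UW 2 by simp
  qed
  consider "rel 5 0 1" "rel 0 5 1" | "rel 5 0 1" "\<not> rel 0 5 1" "rel 1 3 0 \<or> rel 1 (- 3) 0"
    | "\<not> rel 5 0 1" "rel 0 5 1" "rel 3 1 0 \<or> rel 3 (- 1) 0"
    | "rel 3 1 0 \<or> rel 3 (- 1) 0" "rel 1 3 0 \<or> rel 1 (- 3) 0"
    using V W by blast
  then show False
  proof cases
    case 1
    then show ?thesis by (rule rel_5_conflict)
  next
    case 2
    have "\<not> rel 1 1 0" "\<not> rel 1 (- 1) 0" "\<not> rel 1 2 1" "\<not> rel 1 (- 2) 1"
      using 2 rel_1_conflict(1)[of 1] rel_1_conflict(1)[of "- 1"]
        rel_5_3_conflict(1)[of 1 1] rel_5_3_conflict(1)[of 1 "- 1"]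
        rel_5_3_conflict(1)[of "- 1" 1] rel_5_3_conflict(1)[of "- 1" "- 1"] by auto
    \<comment> \<open>The left side of \<open>UV\<close> is now exactly 4, while
      \<open>rel 5 0 1\<close> alone puts 8 on the right.\<close>
    then show ?thesis using UV 2(1,2) by simp
  next
    case 3
    have "\<not> rel 1 1 0" "\<not> rel 1 (- 1) 0" "\<not> rel 2 1 1" "\<not> rel 2 (- 1) 1"
      using 3 rel_1_conflict(2)[of 1] rel_1_conflict(2)[of "- 1"]
        rel_5_3_conflict(2)[of 1 1] rel_5_3_conflict(2)[of 1 "- 1"]
        rel_5_3_conflict(2)[of "- 1" 1] rel_5_3_conflict(2)[of "- 1" "- 1"] by auto
    then show ?thesis using UW 3(1,2) by simp
  next
    case 4
    then show ?thesis
      using rel_3_conflict[of 1 1] rel_3_conflict[of 1 "- 1"]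
        rel_3_conflict[of "- 1" 1] rel_3_conflict[of "- 1" "- 1"] by auto
  qed
qed

end

section \<open>Transfer to graphs of Type 4\<close>

lemma card_T4_le: "card (pverts (T4 k r s)) \<le> 6 * k"
proof -
  have image: "card (f ` {..<2 * k}) \<le> 2 * k" for f :: "nat \<Rightarrow> t4_vertex"
    using card_image_le[of "{..<2 * k}" f] by simp
  have "card (pverts (T4 k r s))
      \<le> card (U ` {..<2 * k}) + card (V ` {..<2 * k}) + card (W ` {..<2 * k})"
    unfolding T4_def pair_pre_digraph.select_convs
    by (rule order.trans[OF card_Un_le add_right_mono[OF card_Un_le]])
  also have "\<dots> \<le> 6 * k"
    using image[of U] image[of V] image[of W] by linarith
  finally show ?thesis .
qed

text \<open>A digraph isomorphism maps vertices and arcs separately; since tail and head are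
  \<open>fst\<close> and \<open>snd\<close> on both sides, the vertex map determines the arc
  map.\<close>

lemma digraph_iso_with_projE:
  assumes "pair_wf_digraph G" "digraph_iso (with_proj G) (with_proj H)"
  obtains h where "inj_on h (pverts G)" "pverts H = h ` pverts G" "parcs H = map_prod h h ` parcs G"
proof -
  interpret pair_wf_digraph G by fact
  obtain f where f: "digraph_isomorphism f" "with_proj H = app_iso f (with_proj G)"
    using assms(2) unfolding digraph_iso_def by auto
  have "verts (with_proj H) = iso_verts f ` pverts G" "arcs (with_proj H) = iso_arcs f ` parcs G"
    "tail (with_proj H) = iso_tail f" "head (with_proj H) = iso_head f"
    unfolding f(2) by simp_all
  then have H: "pverts H = iso_verts f ` pverts G" "parcs H = iso_arcs f ` parcs G"
    "iso_tail f = fst" "iso_head f = snd" by simp_all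
  have "iso_arcs f e = map_prod (iso_verts f) (iso_verts f) e" if "e \<in> parcs G" for e
    using iso_verts_tail[OF f(1) that] iso_verts_head[OF f(1) that] H(3,4)
    by (simp add: prod_eq_iff)
  then have "parcs H = map_prod (iso_verts f) (iso_verts f) ` parcs G"
    using H(2) by simp
  then show thesis
    using that H(1) digraph_isomorphism_inj_on_verts[OF f(1)] by simp
qed

theorem theorem7p2:
  shows "\<not> (\<exists>G :: 'a pair_pre_digraph.
    cubic G \<and> vertex_transitive G \<and> tricirculant G \<and> type4 G \<and> 54 \<le> card (pverts G))"
proof
  assume "\<exists>G :: 'a pair_pre_digraph.
    cubic G \<and> vertex_transitive G \<and> tricirculant G \<and> type4 G \<and> 54 \<le> card (pverts G)"
  then obtain G :: "'a pair_pre_digraph" and k r s where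
    G: "pair_graph G" "connected (with_proj G)" "vertex_transitive G"
    "\<And>v. v \<in> pverts G \<Longrightarrow> out_degree (with_proj G) v = 3" "54 \<le> card (pverts G)"
    and iso: "digraph_iso (with_proj G) (with_proj (T4 k r s))" and k: "0 < k"
    unfolding cubic_def type4_def by blast
  interpret pair_graph G by fact
  interpret T4_params k r s by unfold_locales fact
  obtain h where inj: "inj_on h (pverts G)" and verts: "pverts (T4 k r s) = h ` pverts G"
    and arcs: "E = map_prod h h ` parcs G"
    using iso by (rule digraph_iso_with_projE[OF pair_wf_digraph_axioms])
  have sub: "parcs G \<subseteq> pverts G \<times> pverts G"
    using wellformed' by auto
  have deg: "card {z. (x, z) \<in> E} = 3" if "x \<in> pverts (T4 k r s)" for x
  proof -
    from that obtain v where v: "v \<in> pverts G" "x = h v" unfolding verts by blast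
    have "out_arcs (with_proj G) v = Pair v ` {z. (v, z) \<in> parcs G}"
      by (auto simp: out_arcs_def)
    then have "card {z. (v, z) \<in> parcs G} = 3"
      using G(4)[OF v(1)] by (simp add: out_degree_def card_image inj_on_def)
    then show ?thesis
      using card_image_neighbours[OF inj sub arcs v(1)] v(2) by simp
  qed
  have res: "res 0 = 0" by (simp add: res_def)
  have verts_0: "U 0 \<in> pverts (T4 k r s)" "V 0 \<in> pverts (T4 k r s)" "W 0 \<in> pverts (T4 k r s)"
    using k by (auto simp: T4_def)
  have "connected (with_proj (T4 k r s))"
    using iso G(2) connectedI_app_iso unfolding digraph_iso_def by metis
  then have "gcd k (gcd r s) = 1" by (rule connected_imp_coprime)
  \<comment> \<open>The order is at most \<open>6 * k\<close>, so \<open>k\<close> is even at least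
    9.\<close>
  moreover have "5 < k"
    using G(5) card_image[OF inj] verts card_T4_le[of k r s] by simp
  moreover have "\<not> 2 * k dvd 2 * r" "\<not> 2 * k dvd 2 * s"
    using degree_V[of 0] degree_W[of 0] deg[OF verts_0(2)] deg[OF verts_0(3)] unfolding res by blast+
  ultimately interpret connected_type4_graph k r s
    by unfold_locales
  \<comment> \<open>Transitivity is applied in \<open>G\<close>, and \<open>h\<close> carries the
    counts over to \<open>T4 k r s\<close>.\<close>
  have "nb_closed_walks E 8 x = nb_closed_walks E 8 y"
    if xy: "x \<in> pverts (T4 k r s)" "y \<in> pverts (T4 k r s)" for x y
  proof -
    obtain v w where vw: "v \<in> pverts G" "x = h v" "w \<in> pverts G" "y = h w"
      using xy unfolding verts by blast
    then show ?thesis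
      using vertex_transitive_nb_closed_walks[OF G(1,3) vw(1,3)]
      by (simp add: nb_closed_walks_image[OF inj sub arcs])
  qed
  then show False
    using nb_closed_8_walks_distinct verts_0 by blast
qed

end
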